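(* Let $a = h\sum_{j=1}^{N_\Theta}\alpha_j\sum_{k=1}^N\theta_{jk}$ and let $0<\delta t\le 1/a$ (with $1/a=+\infty$ if $a=0$). Then the Euler–Chang–Cooper scheme $$(I-\delta t\,A)f^{m}=f^{m-1}+\delta t\,Q(f^{m-1};\bar\alpha)$$ is stable in the $1$-norm, that is, $\Vert f^m\Vert_1\le\Vert f^{m-1}\Vert_1$ for all $m$, where $\Vert f\Vert_1=\sum_{i=1}^N|f_i|$.
   Context: Setting. $\Omega=[\Omega_a,\Omega_b]$ is an interval with its end points identified (a torus). $b\in\mathbb{R}$, $\sigma^2>0$, $B=-b$, $C=\sigma^2/2>0$. The space grid is $x_i=\Omega_a+ih$, $i=0,\dots,N$, $h=(\Omega_b-\Omega_a)/N$, $N\ge 3$; since $x_0$ and $x_N$ are identified, grid functions are vectors $f=(f_1,\dots,f_N)^\top\in\mathbb{R}^N$ with indices read modulo $N$. Matrix $A$ (Chang–Cooper discretization of $f\mapsto\partial_x(Bf+C\partial_x f)$): let $\omega=\exp(hB/C)$ and $\beta=B/(\omega-1)$ (with $\beta=C/h$ if $B=0$), so $\beta>0$. $A\in\mathbb{R}^{N\times N}$ has entries $A_{i,i}=-\beta(1+\omega)/h$, $A_{i,i-1}=\beta/h$, $A_{i,i+1}=\omega\beta/h$, $A_{1,N}=\beta/h$, $A_{N,1}=\omega\beta/h$, and all other entries $0$. Jump term: $\bar\alpha=(\alpha_1,\dots,\alpha_{N_\Theta})$ with $\alpha_j\ge0$. $\Delta=(\Omega_b-\Omega_a)/N_\Theta$,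 $\theta_j=\Omega_a+\Delta(j-1)$, and $\Theta_j$ is the hat function on the torus $\Theta_j(s)=1+(s-\theta_j)/\Delta$ on $[\theta_j-\Delta,\theta_j]$, $\Theta_j(s)=1-(s-\theta_j)/\Delta$ on $[\theta_j,\theta_j+\Delta]$, zero elsewhere (extended periodically, $\Theta_1\equiv\Theta_{N_\Theta+1}$). With $s_k=x_k$, put $\theta_{jk}=\Theta_j(s_k)\ge0$. For a grid function $f$, $\hat f_{ik}$ is $f$ translated by $s_k$ and continued by periodicity, i.e. $\hat f_{ik}=f_{i+\sigma_k}$ (index mod $N$), where the integer $\sigma_k$ is the number of grid cells of the translation by $s_k$ ($\sigma_k=s_k/h$ when $0$ is a grid point; the result does not depend on which integers $\sigma_k$ are used). Then $Q(f;\bar\alpha)\in\mathbb{R}^N$ is given by $$Q(f;\bar\alpha)_i=h\sum_{j=1}^{N_\Theta}\alpha_j\sum_{k=1}^N\hat f_{ik}\,\theta_{jk}-a f_i.$$ *)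

theory Defs
  imports Complex_Main "Jordan_Normal_Form.Matrix"
begin

text \<open>
  The torus is the interval from \<open>\<Omega>\<^sub>a\<close> to \<open>\<Omega>\<^sub>b\<close> with its end points identified.
  Grid functions \<open>(f\<^sub>1, \<dots>, f\<^sub>N)\<close> and \<open>N \<times> N\<close> matrices are library vectors and matrices,
  which are indexed from 0: the entry with mathematical index \<open>i \<in> {1..N}\<close> is stored at
  position \<open>i - 1\<close>.
\<close>

definition grid_step :: "real \<Rightarrow> real \<Rightarrow> nat \<Rightarrow> real" where
  "grid_step \<Omega>\<^sub>a \<Omega>\<^sub>b N = (\<Omega>\<^sub>b - \<Omega>\<^sub>a) / real N"

definition grid_point :: "real \<Rightarrow> real \<Rightarrow> nat \<Rightarrow> nat \<Rightarrow> real" where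
  "grid_point \<Omega>\<^sub>a \<Omega>\<^sub>b N i = \<Omega>\<^sub>a + real i * grid_step \<Omega>\<^sub>a \<Omega>\<^sub>b N"

text \<open>The entry \<open>f\<^sub>i\<close> for an arbitrary integer \<open>i\<close>, read modulo \<open>N\<close>.\<close>

definition periodic_entry :: "nat \<Rightarrow> real vec \<Rightarrow> int \<Rightarrow> real" where
  "periodic_entry N f i = f $ nat ((i - 1) mod int N)"

definition vec_norm1 :: "real vec \<Rightarrow> real" where
  "vec_norm1 f = (\<Sum>i<dim_vec f. \<bar>f $ i\<bar>)"


text \<open>Chang--Cooper discretization of \<open>f \<mapsto> \<partial>\<^sub>x (B f + C \<partial>\<^sub>x f)\<close> with periodic boundary conditions.\<close>

definition cc_omega :: "real \<Rightarrow> real \<Rightarrow> real \<Rightarrow> real" where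
  "cc_omega h B C = exp (h * B / C)"

definition cc_beta :: "real \<Rightarrow> real \<Rightarrow> real \<Rightarrow> real" where
  "cc_beta h B C = (if B = 0 then C / h else B / (cc_omega h B C - 1))"

text \<open>Here \<open>i\<close> and \<open>j\<close> range over \<open>{1..N}\<close>.\<close>

definition cc_entry :: "nat \<Rightarrow> real \<Rightarrow> real \<Rightarrow> real \<Rightarrow> nat \<Rightarrow> nat \<Rightarrow> real" where
  "cc_entry N h B C i j =
    (let \<omega> = cc_omega h B C; \<beta> = cc_beta h B C in
     if j = i then - \<beta> * (1 + \<omega>) / h
     else if i = j + 1 then \<beta> / h
     else if j = i + 1 then \<omega> * \<beta> / h
     else if i = 1 \<and> j = N then \<beta> / h
     else if i = N \<and> j = 1 then \<omega> * \<beta> / h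
     else 0)"

definition chang_cooper :: "nat \<Rightarrow> real \<Rightarrow> real \<Rightarrow> real \<Rightarrow> real mat" where
  "chang_cooper N h B C = mat N N (\<lambda>(i, j). cc_entry N h B C (i + 1) (j + 1))"


definition hat_step :: "real \<Rightarrow> real \<Rightarrow> nat \<Rightarrow> real" where
  "hat_step \<Omega>\<^sub>a \<Omega>\<^sub>b N\<^sub>\<Theta> = (\<Omega>\<^sub>b - \<Omega>\<^sub>a) / real N\<^sub>\<Theta>"

definition hat_node :: "real \<Rightarrow> real \<Rightarrow> nat \<Rightarrow> nat \<Rightarrow> real" where
  "hat_node \<Omega>\<^sub>a \<Omega>\<^sub>b N\<^sub>\<Theta> j = \<Omega>\<^sub>a + hat_step \<Omega>\<^sub>a \<Omega>\<^sub>b N\<^sub>\<Theta> * (real j - 1)"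

definition hat_line :: "real \<Rightarrow> real \<Rightarrow> real \<Rightarrow> real" where
  "hat_line \<Delta> \<theta> s =
    (if \<theta> - \<Delta> \<le> s \<and> s \<le> \<theta> then 1 + (s - \<theta>) / \<Delta>
     else if \<theta> \<le> s \<and> s \<le> \<theta> + \<Delta> then 1 - (s - \<theta>) / \<Delta>
     else 0)"

text \<open>
  With \<open>L = \<Omega>\<^sub>b - \<Omega>\<^sub>a\<close>, the point \<open>s - L \<lfloor>(s - \<theta>) / L + 1/2\<rfloor>\<close> is the representative of \<open>s\<close> modulo \<open>L\<close>
  in \<open>[\<theta> - L/2, \<theta> + L/2)\<close>. For at least two hat functions the support of \<open>hat_line \<Delta> \<theta>\<close> lies in
  \<open>[\<theta> - L/2, \<theta> + L/2]\<close>, so this is the periodic extension.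
\<close>

definition hat_torus :: "real \<Rightarrow> real \<Rightarrow> nat \<Rightarrow> nat \<Rightarrow> real \<Rightarrow> real" where
  "hat_torus \<Omega>\<^sub>a \<Omega>\<^sub>b N\<^sub>\<Theta> j s =
    (let L = \<Omega>\<^sub>b - \<Omega>\<^sub>a; \<theta> = hat_node \<Omega>\<^sub>a \<Omega>\<^sub>b N\<^sub>\<Theta> j in
     hat_line (hat_step \<Omega>\<^sub>a \<Omega>\<^sub>b N\<^sub>\<Theta>) \<theta> (s - L * of_int \<lfloor>(s - \<theta>) / L + 1 / 2\<rfloor>))"

lemma hat_torus_periodic:
  assumes "\<Omega>\<^sub>a < \<Omega>\<^sub>b"
  shows "hat_torus \<Omega>\<^sub>a \<Omega>\<^sub>b N\<^sub>\<Theta> j (s + of_int n * (\<Omega>\<^sub>b - \<Omega>\<^sub>a)) = hat_torus \<Omega>\<^sub>a \<Omega>\<^sub>b N\<^sub>\<Theta> j s"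
proof -
  define L where "L = \<Omega>\<^sub>b - \<Omega>\<^sub>a"
  define \<theta> where "\<theta> = hat_node \<Omega>\<^sub>a \<Omega>\<^sub>b N\<^sub>\<Theta> j"
  have "L > 0" using assms by (simp add: L_def)
  then have "(s + of_int n * L - \<theta>) / L + 1 / 2 = ((s - \<theta>) / L + 1 / 2) + of_int n"
    by (simp add: field_simps)
  then have "\<lfloor>(s + of_int n * L - \<theta>) / L + 1 / 2\<rfloor> = \<lfloor>(s - \<theta>) / L + 1 / 2\<rfloor> + n"
    by (metis floor_add_int)
  then show ?thesis
    unfolding hat_torus_def Let_def L_def [symmetric] \<theta>_def [symmetric]
    by (simp add: algebra_simps)
qed

lemma hat_torus_eq_hat_line:
  assumes "\<Omega>\<^sub>a < \<Omega>\<^sub>b" and "N\<^sub>\<Theta> \<ge> 2"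
    and s: "\<bar>s - hat_node \<Omega>\<^sub>a \<Omega>\<^sub>b N\<^sub>\<Theta> j\<bar> \<le> (\<Omega>\<^sub>b - \<Omega>\<^sub>a) / 2"
  shows "hat_torus \<Omega>\<^sub>a \<Omega>\<^sub>b N\<^sub>\<Theta> j s =
    hat_line (hat_step \<Omega>\<^sub>a \<Omega>\<^sub>b N\<^sub>\<Theta>) (hat_node \<Omega>\<^sub>a \<Omega>\<^sub>b N\<^sub>\<Theta> j) s"
proof -
  define L where "L = \<Omega>\<^sub>b - \<Omega>\<^sub>a"
  define \<theta> where "\<theta> = hat_node \<Omega>\<^sub>a \<Omega>\<^sub>b N\<^sub>\<Theta> j"
  define \<Delta> where "\<Delta> = hat_step \<Omega>\<^sub>a \<Omega>\<^sub>b N\<^sub>\<Theta>"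
  have L: "L > 0" using assms by (simp add: L_def)
  have "L * 2 \<le> L * real N\<^sub>\<Theta>"
    using L assms(2) by (intro mult_left_mono) auto
  then have D: "0 < \<Delta>" "\<Delta> \<le> L / 2"
    using L assms(2) by (auto simp: \<Delta>_def hat_step_def L_def [symmetric] field_simps)
  have s': "\<bar>s - \<theta>\<bar> \<le> L / 2" using s by (simp add: L_def \<theta>_def)
  show ?thesis
  proof (cases "s - \<theta> = L / 2")
    case True
    then have "s = \<theta> + L / 2" by simp
    then have "\<lfloor>(s - \<theta>) / L + 1 / 2\<rfloor> = 1" using L by simp
    moreover have "hat_line \<Delta> \<theta> (s - L) = hat_line \<Delta> \<theta> s"
      using True D by (auto simp: hat_line_def field_simps)
    ultimately show ?thesis
      unfolding hat_torus_def Let_def L_def [symmetric] \<theta>_def [symmetric] \<Delta>_def [symmetric] by simp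
  next
    case False
    then have "- (L / 2) \<le> s - \<theta>" "s - \<theta> < L / 2" using s' by linarith+
    then have "\<lfloor>(s - \<theta>) / L + 1 / 2\<rfloor> = 0"
      using L by (simp add: floor_eq_iff field_simps)
    then show ?thesis
      unfolding hat_torus_def Let_def L_def [symmetric] \<theta>_def [symmetric] \<Delta>_def [symmetric] by simp
  qed
qed


text \<open>The numbers \<open>\<theta>\<^sub>j\<^sub>k = \<Theta>\<^sub>j(s\<^sub>k)\<close> with \<open>s\<^sub>k = x\<^sub>k\<close>.\<close>

definition hat_weight :: "real \<Rightarrow> real \<Rightarrow> nat \<Rightarrow> nat \<Rightarrow> nat \<Rightarrow> nat \<Rightarrow> real" where
  "hat_weight \<Omega>\<^sub>a \<Omega>\<^sub>b N N\<^sub>\<Theta> j k = hat_torus \<Omega>\<^sub>a \<Omega>\<^sub>b N\<^sub>\<Theta> j (grid_point \<Omega>\<^sub>a \<Omega>\<^sub>b N k)"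

text \<open>
  The number \<open>shift k\<close> is the number of grid cells of the translation by \<open>s\<^sub>k\<close>; it is a parameter
  because \<open>s\<^sub>k / h\<close> is an integer only if 0 is a grid point.
\<close>

definition jump_term ::
    "real \<Rightarrow> real \<Rightarrow> nat \<Rightarrow> nat \<Rightarrow> (nat \<Rightarrow> int) \<Rightarrow> real \<Rightarrow> (nat \<Rightarrow> real) \<Rightarrow> real vec \<Rightarrow> real vec" where
  "jump_term \<Omega>\<^sub>a \<Omega>\<^sub>b N N\<^sub>\<Theta> shift a \<alpha> f =
    vec N (\<lambda>i. let i' = int i + 1 in
      grid_step \<Omega>\<^sub>a \<Omega>\<^sub>b N * (\<Sum>j = 1..N\<^sub>\<Theta>. \<alpha> j *
        (\<Sum>k = 1..N. periodic_entry N f (i' + shift k) * hat_weight \<Omega>\<^sub>a \<Omega>\<^sub>b N N\<^sub>\<Theta> j k))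
      - a * periodic_entry N f i')"

end

theory Submission
  imports Defs
begin

text \<open>
  Both halves of a time step are governed by column sums.

  The implicit half inverts \<open>I - \<delta>t A\<close>. The off-diagonal entries of \<open>A\<close> are nonnegative and its
  columns sum to zero: the discrete drift-diffusion only moves mass between neighbouring cells.
  Testing \<open>(I - \<delta>t A) f\<close> against the signs of \<open>f\<close> then gives
  \<open>\<parallel>f\<parallel>\<^sub>1 \<le> \<parallel>(I - \<delta>t A) f\<parallel>\<^sub>1\<close> for every \<open>\<delta>t \<ge> 0\<close>
  (\<open>vec_norm1_le_implicit_step\<close>), so the inverse is a contraction without any restriction on the step.

  The explicit half maps \<open>f\<close> to \<open>(1 - \<delta>t a) f + \<delta>t \<Sum>\<^sub>k w\<^sub>k S\<^sub>k f\<close>, where \<open>S\<^sub>k\<close> is the translation by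
  \<open>shift k\<close> cells, \<open>w\<^sub>k = h \<Sum>\<^sub>j \<alpha>\<^sub>j \<theta>\<^sub>j\<^sub>k \<ge> 0\<close>, and \<open>a = \<Sum>\<^sub>k w\<^sub>k\<close>. The condition \<open>\<delta>t a \<le> 1\<close> says
  exactly that this is a convex combination of translations of \<open>f\<close>. Translations permute the entries
  on the torus, so each of them preserves the 1-norm, and the triangle inequality shows that the
  combination does not increase it (\<open>vec_norm1_explicit_step_le\<close>).
\<close>

text \<open>
  Multiply the \<open>i\<close>-th entry of \<open>(I - t A) f\<close> by the sign of \<open>f\<^sub>i\<close>. On the diagonal, where \<open>A\<close> may be
  negative, the sign turns \<open>f\<^sub>i\<close> into \<open>\<bar>f\<^sub>i\<bar>\<close> without loss; off the diagonal \<open>A\<close> is nonnegative, so that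
  replacing the signed \<open>f\<^sub>j\<close> by \<open>\<bar>f\<^sub>j\<bar>\<close> only helps. After summation over \<open>i\<close> only column sums of \<open>A\<close> remain.
\<close>

lemma vec_norm1_le_implicit_step:
  fixes A :: "real mat" and f :: "real vec" and t :: real
  assumes A: "A \<in> carrier_mat N N" and f: "f \<in> carrier_vec N" and t: "t \<ge> 0"
    and off_diag: "\<And>i j. i < N \<Longrightarrow> j < N \<Longrightarrow> i \<noteq> j \<Longrightarrow> A $$ (i, j) \<ge> 0"
    and col_sum: "\<And>j. j < N \<Longrightarrow> (\<Sum>i<N. A $$ (i, j)) \<le> 0"
  shows "vec_norm1 f \<le> vec_norm1 ((1\<^sub>m N - t \<cdot>\<^sub>m A) *\<^sub>v f)"
proof -
  define g where "g = (1\<^sub>m N - t \<cdot>\<^sub>m A) *\<^sub>v f"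
  have g: "g $ i = f $ i - t * (\<Sum>j<N. A $$ (i, j) * f $ j)" if "i < N" for i
  proof -
    have "(1\<^sub>m N - t \<cdot>\<^sub>m A) *\<^sub>v f = 1\<^sub>m N *\<^sub>v f - (t \<cdot>\<^sub>m A) *\<^sub>v f"
      using A f by (intro minus_mult_distrib_mat_vec) auto
    then show ?thesis
      using that A f unfolding g_def
      by (simp add: scalar_prod_def sum_distrib_left mult.assoc lessThan_atLeast0)
  qed
  have signed: "sgn (f $ i) * (A $$ (i, j) * f $ j) \<le> A $$ (i, j) * \<bar>f $ j\<bar>"
    if "i < N" "j < N" for i j
  proof (cases "i = j")
    case True
    then show ?thesis by (simp add: abs_sgn mult_ac)
  next
    case False
    have "sgn (f $ i) * f $ j \<le> \<bar>f $ j\<bar>"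
      by (auto simp: sgn_if)
    then show ?thesis
      using mult_left_mono[OF _ off_diag[OF that False]] by (metis mult.left_commute)
  qed
  have "(\<Sum>i<N. \<Sum>j<N. sgn (f $ i) * (A $$ (i, j) * f $ j)) \<le> (\<Sum>i<N. \<Sum>j<N. A $$ (i, j) * \<bar>f $ j\<bar>)"
    by (intro sum_mono signed) auto
  also have "\<dots> = (\<Sum>j<N. (\<Sum>i<N. A $$ (i, j)) * \<bar>f $ j\<bar>)"
    by (subst sum.swap) (simp add: sum_distrib_right)
  also have "\<dots> \<le> 0"
    by (intro sum_nonpos mult_nonpos_nonneg col_sum) auto
  finally have loss: "t * (\<Sum>i<N. \<Sum>j<N. sgn (f $ i) * (A $$ (i, j) * f $ j)) \<le> 0"
    using t by (simp add: mult_nonneg_nonpos)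
  have "(\<Sum>i<N. \<bar>f $ i\<bar>) \<le>
      (\<Sum>i<N. \<bar>f $ i\<bar>) - t * (\<Sum>i<N. \<Sum>j<N. sgn (f $ i) * (A $$ (i, j) * f $ j))"
    using loss by simp
  also have "\<dots> = (\<Sum>i<N. sgn (f $ i) * g $ i)"
    by (simp add: g abs_sgn algebra_simps sum_subtractf sum_distrib_left)
  also have "\<dots> \<le> (\<Sum>i<N. \<bar>g $ i\<bar>)"
    by (intro sum_mono) (auto simp: sgn_if)
  finally show ?thesis
    using A f by (simp add: vec_norm1_def g_def)
qed

lemma cc_beta_pos:
  assumes "h > 0" and "C > 0"
  shows "cc_beta h B C > 0"
proof (cases B "0 :: real" rule: linorder_cases)
  case less
  then have "h * B / C < 0"
    using assms by (simp add: divide_neg_pos mult_pos_neg)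
  then have "cc_omega h B C < 1"
    by (simp add: cc_omega_def)
  then show ?thesis
    using less by (simp add: cc_beta_def divide_neg_neg)
next
  case greater
  then have "h * B / C > 0"
    using assms by simp
  then have "cc_omega h B C > 1"
    by (simp add: cc_omega_def)
  then show ?thesis
    using greater by (simp add: cc_beta_def)
qed (use assms in \<open>simp add: cc_beta_def\<close>)

lemma chang_cooper_off_diag_nonneg:
  assumes "h > 0" and "C > 0" and "i < N" and "j < N" and "i \<noteq> j"
  shows "chang_cooper N h B C $$ (i, j) \<ge> 0"
  using assms cc_beta_pos[OF assms(1,2), of B]
  by (simp add: chang_cooper_def cc_entry_def Let_def cc_omega_def)

text \<open>
  Column \<open>j\<close> holds \<open>\<beta>/h\<close> in the cyclically following row, \<open>\<omega>\<beta>/h\<close> in the cyclically preceding row,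
  and the negative of their sum on the diagonal. For \<open>N \<ge> 3\<close> these three rows are distinct.
\<close>

lemma chang_cooper_column_sum:
  assumes N: "N \<ge> 3" and j: "j < N"
  shows "(\<Sum>i<N. chang_cooper N h B C $$ (i, j)) = 0"
proof -
  define \<omega> \<beta> where "\<omega> = cc_omega h B C" and "\<beta> = cc_beta h B C"
  define d x y where "d = - \<beta> * (1 + \<omega>) / h" and "x = \<beta> / h" and "y = \<omega> * \<beta> / h"
  define p q where "p = (if j = N - 1 then 0 else j + 1)" and "q = (if j = 0 then N - 1 else j - 1)"
  have pq: "p < N" "q < N"
    using N j by (auto simp: p_def q_def)
  have distinct: "p \<noteq> j" "q \<noteq> j" "p \<noteq> q"
    using N j by (auto simp: p_def q_def split: if_splits)
  have "chang_cooper N h B C $$ (i, j) =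
      (if i = j then d else 0) + (if i = p then x else 0) + (if i = q then y else 0)"
    if i: "i < N" for i
  proof -
    have p_iff: "i = p \<longleftrightarrow> i = j + 1 \<or> i = 0 \<and> j = N - 1"
      and q_iff: "i = q \<longleftrightarrow> j = i + 1 \<or> i = N - 1 \<and> j = 0"
      using N i j by (auto simp: p_def q_def)
    have "chang_cooper N h B C $$ (i, j) =
        (if j = i then d else if i + 1 = j + 1 + 1 then x else if j + 1 = i + 1 + 1 then y
         else if i + 1 = 1 \<and> j + 1 = N then x else if i + 1 = N \<and> j + 1 = 1 then y else 0)"
      using i j by (simp add: chang_cooper_def cc_entry_def Let_def d_def x_def y_def \<omega>_def \<beta>_def)
    also have "\<dots> = (if i = j then d else if i = p then x else if i = q then y else 0)"
      using N i j unfolding p_iff q_iff by (auto split: if_splits)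
    also have "\<dots> = (if i = j then d else 0) + (if i = p then x else 0) + (if i = q then y else 0)"
      using distinct by simp
    finally show ?thesis .
  qed
  then have "(\<Sum>i<N. chang_cooper N h B C $$ (i, j)) = d + x + y"
    using j pq by (simp add: sum.distrib)
  also have "\<dots> = 0"
    unfolding d_def x_def y_def
    by (simp add: add_divide_distrib [symmetric] algebra_simps)
  finally show ?thesis .
qed

lemma hat_weight_nonneg:
  assumes "\<Omega>\<^sub>a < \<Omega>\<^sub>b" and "N\<^sub>\<Theta> \<ge> 1"
  shows "hat_weight \<Omega>\<^sub>a \<Omega>\<^sub>b N N\<^sub>\<Theta> j k \<ge> 0"
proof -
  have "hat_step \<Omega>\<^sub>a \<Omega>\<^sub>b N\<^sub>\<Theta> > 0"
    using assms by (simp add: hat_step_def)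
  then have "hat_line (hat_step \<Omega>\<^sub>a \<Omega>\<^sub>b N\<^sub>\<Theta>) \<theta> s \<ge> 0" for \<theta> s
    by (auto simp: hat_line_def field_simps)
  then show ?thesis
    by (simp add: hat_weight_def hat_torus_def Let_def)
qed

lemma periodic_entry_Suc:
  assumes "i < N"
  shows "periodic_entry N f (int i + 1) = f $ i"
  using assms by (simp add: periodic_entry_def)

lemma sum_periodic_entry_shift:
  assumes N: "N > 0"
  shows "(\<Sum>i<N. \<bar>periodic_entry N f (int i + 1 + c)\<bar>) = (\<Sum>i<N. \<bar>f $ i\<bar>)"
proof -
  have "(\<Sum>i<N. \<bar>f $ nat ((int i + c) mod int N)\<bar>) = (\<Sum>i<N. \<bar>f $ i\<bar>)"
    by (rule sum.reindex_bij_witness[where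
          i = "\<lambda>i. nat ((int i - c) mod int N)" and j = "\<lambda>i. nat ((int i + c) mod int N)"])
      (use N in \<open>auto simp: nat_less_iff mod_simps\<close>)
  then show ?thesis
    by (simp add: periodic_entry_def add_ac)
qed

text \<open>
  Each translation of \<open>f\<close> has the same 1-norm as \<open>f\<close>, so that the translated parts contribute at most
  the total weight times the 1-norm of \<open>f\<close>;
  the bound \<open>t * sum w K \<le> 1\<close> keeps the coefficient of \<open>f\<close> itself nonnegative.
\<close>

lemma vec_norm1_explicit_step_le:
  fixes w :: "nat \<Rightarrow> real" and c :: "nat \<Rightarrow> int"
  assumes N: "N > 0" and f: "f \<in> carrier_vec N" and g: "g \<in> carrier_vec N"
    and w: "\<And>k. k \<in> K \<Longrightarrow> w k \<ge> 0" and t: "t \<ge> 0" "t * sum w K \<le> 1"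
    and g_eq: "\<And>i. i < N \<Longrightarrow> g $ i = (1 - t * sum w K) * f $ i
      + t * (\<Sum>k\<in>K. w k * periodic_entry N f (int i + 1 + c k))"
  shows "vec_norm1 g \<le> vec_norm1 f"
proof -
  define S where "S = (\<Sum>i<N. \<bar>f $ i\<bar>)"
  have "\<bar>g $ i\<bar> \<le> (1 - t * sum w K) * \<bar>f $ i\<bar>
      + t * (\<Sum>k\<in>K. w k * \<bar>periodic_entry N f (int i + 1 + c k)\<bar>)" if "i < N" for i
  proof -
    have "\<bar>\<Sum>k\<in>K. w k * periodic_entry N f (int i + 1 + c k)\<bar>
        \<le> (\<Sum>k\<in>K. w k * \<bar>periodic_entry N f (int i + 1 + c k)\<bar>)"
      by (rule order_trans[OF sum_abs]) (simp add: abs_mult w)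
    then have "t * \<bar>\<Sum>k\<in>K. w k * periodic_entry N f (int i + 1 + c k)\<bar>
        \<le> t * (\<Sum>k\<in>K. w k * \<bar>periodic_entry N f (int i + 1 + c k)\<bar>)"
      using t by (simp add: mult_left_mono)
    then show ?thesis
      unfolding g_eq[OF that] using t
      by (intro order_trans[OF abs_triangle_ineq] add_mono) (simp_all add: abs_mult)
  qed
  then have "(\<Sum>i<N. \<bar>g $ i\<bar>) \<le> (\<Sum>i<N. (1 - t * sum w K) * \<bar>f $ i\<bar>
      + t * (\<Sum>k\<in>K. w k * \<bar>periodic_entry N f (int i + 1 + c k)\<bar>))"
    by (intro sum_mono) auto
  also have "\<dots> = (1 - t * sum w K) * S
      + t * (\<Sum>i<N. \<Sum>k\<in>K. w k * \<bar>periodic_entry N f (int i + 1 + c k)\<bar>)"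
    by (simp add: sum.distrib sum_distrib_left S_def)
  also have "(\<Sum>i<N. \<Sum>k\<in>K. w k * \<bar>periodic_entry N f (int i + 1 + c k)\<bar>)
      = (\<Sum>k\<in>K. w k * (\<Sum>i<N. \<bar>periodic_entry N f (int i + 1 + c k)\<bar>))"
    by (subst sum.swap) (simp add: sum_distrib_left)
  also have "\<dots> = sum w K * S"
    by (simp add: sum_periodic_entry_shift[OF N] S_def sum_distrib_right)
  finally show ?thesis
    using f g by (simp add: vec_norm1_def S_def algebra_simps)
qed

text \<open>
  The jump term adds up hat functions first and translations second; in the other order the
  coefficient of each translation becomes visible. Taking \<open>g = 1\<close> identifies the rate \<open>a\<close> with the
  sum of these coefficients.
\<close>

lemma jump_sum_by_translation:
  fixes x :: real and \<alpha> g :: "nat \<Rightarrow> real" and \<theta> :: "nat \<Rightarrow> nat \<Rightarrow> real"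
  shows "x * (\<Sum>j\<in>J. \<alpha> j * (\<Sum>k\<in>K. g k * \<theta> j k)) = (\<Sum>k\<in>K. (x * (\<Sum>j\<in>J. \<alpha> j * \<theta> j k)) * g k)"
  unfolding sum_distrib_left sum_distrib_right by (subst sum.swap) (simp add: mult_ac)

theorem theorem3:
  fixes \<Omega>\<^sub>a \<Omega>\<^sub>b b \<sigma> B C h a \<delta>t :: real
    and N N\<^sub>\<Theta> :: nat
    and \<alpha> :: "nat \<Rightarrow> real"
    and shift :: "nat \<Rightarrow> int"
    and A :: "real mat"
    and Q :: "real vec \<Rightarrow> real vec"
    and f :: "nat \<Rightarrow> real vec"
  assumes "\<Omega>\<^sub>a < \<Omega>\<^sub>b" and "N \<ge> 3" and "N\<^sub>\<Theta> \<ge> 1"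
    and "\<sigma>\<^sup>2 > 0"
    and "B = - b" and "C = \<sigma>\<^sup>2 / 2"
    and "h = grid_step \<Omega>\<^sub>a \<Omega>\<^sub>b N"
    and "A = chang_cooper N h B C"
    and "\<And>j. j \<in> {1..N\<^sub>\<Theta>} \<Longrightarrow> \<alpha> j \<ge> 0"
    and "a = h * (\<Sum>j = 1..N\<^sub>\<Theta>. \<alpha> j * (\<Sum>k = 1..N. hat_weight \<Omega>\<^sub>a \<Omega>\<^sub>b N N\<^sub>\<Theta> j k))"
    and "Q = jump_term \<Omega>\<^sub>a \<Omega>\<^sub>b N N\<^sub>\<Theta> shift a \<alpha>"
    and "0 < \<delta>t" and "a \<noteq> 0 \<longrightarrow> \<delta>t \<le> 1 / a"
    and "\<And>m. f m \<in> carrier_vec N"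
    and "\<And>m. m \<ge> 1 \<Longrightarrow> (1\<^sub>m N - \<delta>t \<cdot>\<^sub>m A) *\<^sub>v f m = f (m - 1) + \<delta>t \<cdot>\<^sub>v Q (f (m - 1))"
  shows "\<forall>m\<ge>1. vec_norm1 (f m) \<le> vec_norm1 (f (m - 1))"
proof (intro allI impI)
  fix m :: nat
  assume m: "m \<ge> 1"
  define F where "F = f (m - 1)"
  define w where "w k = h * (\<Sum>j = 1..N\<^sub>\<Theta>. \<alpha> j * hat_weight \<Omega>\<^sub>a \<Omega>\<^sub>b N N\<^sub>\<Theta> j k)" for k
  have h: "h > 0"
    using assms(1,2,7) by (simp add: grid_step_def)
  have C: "C > 0"
    unfolding assms(6) using assms(4) by (rule half_gt_zero)
  have F: "F \<in> carrier_vec N"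
    using assms(14) by (simp add: F_def)
  have w_nonneg: "w k \<ge> 0" for k
    unfolding w_def using h assms(9) hat_weight_nonneg[OF assms(1,3)]
    by (intro mult_nonneg_nonneg sum_nonneg) auto
  have a: "a = sum w {1..N}"
    using jump_sum_by_translation[where g = "\<lambda>_. 1" and x = h and \<alpha> = \<alpha>
        and J = "{1..N\<^sub>\<Theta>}" and K = "{1..N}" and \<theta> = "hat_weight \<Omega>\<^sub>a \<Omega>\<^sub>b N N\<^sub>\<Theta>"]
    by (simp add: assms(10) w_def)
  have CFL: "\<delta>t * a \<le> 1"
  proof (cases "a = 0")
    case False
    moreover have "a \<ge> 0"
      unfolding a by (intro sum_nonneg w_nonneg)
    ultimately show ?thesis
      using assms(13) by (simp add: field_simps)
  qed simp
  have Q: "Q F \<in> carrier_vec N"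
    by (simp add: assms(11) jump_term_def)
  have Q_entry: "Q F $ i = (\<Sum>k = 1..N. w k * periodic_entry N F (int i + 1 + shift k)) - a * F $ i"
    if "i < N" for i
  proof -
    have "Q F $ i = h * (\<Sum>j = 1..N\<^sub>\<Theta>. \<alpha> j * (\<Sum>k = 1..N. periodic_entry N F (int i + 1 + shift k)
        * hat_weight \<Omega>\<^sub>a \<Omega>\<^sub>b N N\<^sub>\<Theta> j k)) - a * periodic_entry N F (int i + 1)"
      unfolding assms(7,11) jump_term_def Let_def using that by (rule index_vec)
    then show ?thesis
      unfolding jump_sum_by_translation w_def periodic_entry_Suc[OF that] .
  qed
  have "vec_norm1 (f m) \<le> vec_norm1 ((1\<^sub>m N - \<delta>t \<cdot>\<^sub>m A) *\<^sub>v f m)"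
  proof (rule vec_norm1_le_implicit_step)
    show "A \<in> carrier_mat N N"
      by (simp add: assms(8) chang_cooper_def)
  qed (use assms(2,12,14) h C in
      \<open>auto simp: assms(8) chang_cooper_off_diag_nonneg chang_cooper_column_sum\<close>)
  also have "\<dots> = vec_norm1 (F + \<delta>t \<cdot>\<^sub>v Q F)"
    using assms(15)[OF m] by (simp add: F_def)
  also have "\<dots> \<le> vec_norm1 F"
  proof (rule vec_norm1_explicit_step_le[where K = "{1..N}" and w = w and c = shift])
    show "(F + \<delta>t \<cdot>\<^sub>v Q F) $ i = (1 - \<delta>t * sum w {1..N}) * F $ i
        + \<delta>t * (\<Sum>k = 1..N. w k * periodic_entry N F (int i + 1 + shift k))" if "i < N" for i
      using that F Q by (simp add: Q_entry a algebra_simps)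
  qed (use assms(2,12) F Q w_nonneg CFL [unfolded a] in auto)
  finally show "vec_norm1 (f m) \<le> vec_norm1 (f (m - 1))"
    by (simp add: F_def)
qed

end
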